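(* Let $$ G(x)=\left(1-\frac{\ln x}{\ln(1+x)}\right)x\ln x,\quad x>0. $$ Then $G'$ is completely monotonic on $(0,\infty)$; more precisely, $$ (-1)^{k-1}G^{(k)}(x)>0\quad\text{for all } x>0 \text{ and } k=1,2,\ldots. $$
   Context: A function $h:(0,\infty)\to\mathbb R$ is completely monotonic if it is $C^\infty$ and $(-1)^n h^{(n)}(x)\ge 0$ for all $x>0$ and $n=0,1,2,\ldots$. *)

theory Defs
  imports "HOL-Analysis.Analysis"
begin

text \<open>
  Functions on the open half-line are total functions \<^typ>\<open>real \<Rightarrow> real\<close>; since
  \<open>{0<..}\<close> is open, the iterated derivatives at \<open>x > 0\<close> do not depend on the values outside it.
  As \<^const>\<open>deriv\<close> is a total operator, existence of the derivatives is required separately: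
  differentiability of all iterated derivatives (which entails their continuity) is \<open>C\<^sup>\<infinity>\<close>.
\<close>

definition smooth_pos :: "(real \<Rightarrow> real) \<Rightarrow> bool" where
  "smooth_pos h \<longleftrightarrow> (\<forall>n. \<forall>x>0. (deriv ^^ n) h field_differentiable (at x))"

definition completely_monotonic :: "(real \<Rightarrow> real) \<Rightarrow> bool" where
  "completely_monotonic h \<longleftrightarrow>
     smooth_pos h \<and> (\<forall>n. \<forall>x>0. (-1) ^ n * (deriv ^^ n) h x \<ge> 0)"

definition G :: "real \<Rightarrow> real" where
  "G x = (1 - ln x / ln (1 + x)) * x * ln x"

end

theory Submission
  imports Defs
begin

text \<open>
  Put \<open>L = ln (1 + x)\<close> and \<open>u = L - ln x\<close>. Then \<open>G x = x u - x u\<^sup>2 / L\<close>, and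
  \<open>x u\<^sup>2 / L = u \<sqdot> (1 + x) u \<sqdot> p\<close> with \<open>p = x / ((1 + x) L)\<close>. The functions \<open>(x u)'\<close>, \<open>u\<close> and
  \<open>(1 + x) u\<close> are completely monotonic because they are positive and, after one or two
  differentiations, rational; \<open>p\<close> is so because it is the integral of \<open>(1 + x) powr -b\<close> over
  \<open>b \<in> [0, 1]\<close>. As products of completely monotonic functions are completely monotonic, \<open>G'\<close> is
  the sum of two such functions.
\<close>

text \<open>
  Derivatives are given by witnesses rather than by \<^const>\<open>deriv\<close>, so that closure under sums
  and products is a plain induction on the order \<open>n\<close>.
\<close>

primrec strict_cm :: "nat \<Rightarrow> (real \<Rightarrow> real) \<Rightarrow> bool" where
  "strict_cm 0 f \<longleftrightarrow> (\<forall>x>0. f x > 0)"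
| "strict_cm (Suc n) f \<longleftrightarrow> (\<forall>x>0. f x > 0) \<and>
     (\<exists>g. (\<forall>x>0. (f has_real_derivative - g x) (at x)) \<and> strict_cm n g)"

section \<open>Closure under sums and products, and the rational building blocks\<close>

lemma strict_cm_pos: "strict_cm n f \<Longrightarrow> x > 0 \<Longrightarrow> f x > 0"
  by (cases n) auto

lemma strict_cm_SucI:
  assumes "\<And>x. x > 0 \<Longrightarrow> f x > 0" "\<And>x. x > 0 \<Longrightarrow> (f has_real_derivative - g x) (at x)" "strict_cm n g"
  shows "strict_cm (Suc n) f"
  using assms by auto

lemma strict_cm_SucE:
  assumes "strict_cm (Suc n) f"
  obtains g where "\<And>x. x > 0 \<Longrightarrow> (f has_real_derivative - g x) (at x)" "strict_cm n g"
  using assms by auto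

text \<open>Needed because the product rule leaves one factor undifferentiated, and that factor then
  has one order more than its partner.\<close>

lemma strict_cm_pred: "strict_cm (Suc n) f \<Longrightarrow> strict_cm n f"
  by (induction n arbitrary: f) (simp, metis strict_cm.simps(2))

lemma strict_cm_add:
  "strict_cm n f \<Longrightarrow> strict_cm n g \<Longrightarrow> strict_cm n (\<lambda>x. f x + g x)"
proof (induction n arbitrary: f g)
  case (Suc n)
  obtain f' where f': "\<And>x. x > 0 \<Longrightarrow> (f has_real_derivative - f' x) (at x)" "strict_cm n f'"
    using Suc.prems(1) by (rule strict_cm_SucE) (rule that)
  obtain g' where g': "\<And>x. x > 0 \<Longrightarrow> (g has_real_derivative - g' x) (at x)" "strict_cm n g'"
    using Suc.prems(2) by (rule strict_cm_SucE) (rule that)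
  show ?case
  proof (rule strict_cm_SucI)
    show "f x + g x > 0" if "x > 0" for x
      using strict_cm_pos[OF Suc.prems(1) that] strict_cm_pos[OF Suc.prems(2) that] by simp
    show "((\<lambda>x. f x + g x) has_real_derivative - (f' x + g' x)) (at x)" if "x > 0" for x
      by (rule derivative_eq_intros f' g' that)+ simp
    show "strict_cm n (\<lambda>x. f' x + g' x)" by (intro Suc.IH f' g')
  qed
qed (auto intro: add_pos_pos)

text \<open>With the sign absorbed into the witnesses, the product rule reads
  \<open>f' * g + f * g'\<close>, again a sum of products of order \<open>n\<close>; no Leibniz
  formula is required.\<close>

lemma strict_cm_mult:
  "strict_cm n f \<Longrightarrow> strict_cm n g \<Longrightarrow> strict_cm n (\<lambda>x. f x * g x)"
proof (induction n arbitrary: f g)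
  case (Suc n)
  obtain f' where f': "\<And>x. x > 0 \<Longrightarrow> (f has_real_derivative - f' x) (at x)" "strict_cm n f'"
    using Suc.prems(1) by (rule strict_cm_SucE) (rule that)
  obtain g' where g': "\<And>x. x > 0 \<Longrightarrow> (g has_real_derivative - g' x) (at x)" "strict_cm n g'"
    using Suc.prems(2) by (rule strict_cm_SucE) (rule that)
  show ?case
  proof (rule strict_cm_SucI)
    show "f x * g x > 0" if "x > 0" for x
      using strict_cm_pos[OF Suc.prems(1) that] strict_cm_pos[OF Suc.prems(2) that] by simp
    show "((\<lambda>x. f x * g x) has_real_derivative - (f' x * g x + f x * g' x)) (at x)" if "x > 0" for x
      by (rule derivative_eq_intros f' g' that)+ simp
    show "strict_cm n (\<lambda>x. f' x * g x + f x * g' x)"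
      by (rule strict_cm_add[OF
            Suc.IH[OF f'(2) strict_cm_pred[OF Suc.prems(2)]]
            Suc.IH[OF strict_cm_pred[OF Suc.prems(1)] g'(2)]])
  qed
qed (auto intro: mult_pos_pos)

text \<open>Each differentiation multiplies \<open>c\<close> by the exponent and raises the exponent
  by one, so both vary in the induction. The form \<open>Suc m\<close> keeps the new coefficient
  positive.\<close>

lemma strict_cm_inverse_power:
  assumes "a \<ge> 0" "c > 0"
  shows "strict_cm n (\<lambda>x. c / (x + a) ^ Suc m)"
  using assms(2)
proof (induction n arbitrary: c m)
  case 0
  then show ?case using assms(1) by auto
next
  case (Suc n)
  show ?case
  proof (rule strict_cm_SucI)
    fix x :: real assume x: "x > 0"
    with assms(1) have pos: "x + a > 0" by simp
    with Suc.prems show "c / (x + a) ^ Suc m > 0" by simp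
    show "((\<lambda>x. c / (x + a) ^ Suc m) has_real_derivative
        - (c * real (Suc m) / (x + a) ^ Suc (Suc m))) (at x)"
    proof -
      let ?y = "x + a"
      have "((\<lambda>x. c / (x + a) ^ Suc m) has_real_derivative
          - (c * (real (Suc m) * ?y ^ m) / (?y ^ Suc m * ?y ^ Suc m))) (at x)"
      proof -
        have "((\<lambda>x. (x + a) ^ Suc m) has_real_derivative real (Suc m) * ?y ^ m) (at x)"
          using DERIV_power_Suc[OF DERIV_add[OF DERIV_ident DERIV_const]] by simp
        from DERIV_divide[OF DERIV_const this, of c] pos show ?thesis by simp
      qed
      moreover have "?y ^ Suc m * ?y ^ Suc m = ?y ^ m * ?y ^ Suc (Suc m)"
        by (simp add: mult_ac)
      ultimately show ?thesis using pos by (simp del: of_nat_Suc power_Suc)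
    qed
  next
    show "strict_cm n (\<lambda>x. c * real (Suc m) / (x + a) ^ Suc (Suc m))"
      using Suc.prems by (intro Suc.IH) simp
  qed
qed

section \<open>From derivative witnesses to iterated \<open>deriv\<close>\<close>

text \<open>Of the order \<open>n + k\<close>, \<open>k\<close> is spent on differentiating and
  \<open>n\<close> remains. Agreement of \<open>f\<close> and \<open>h\<close> on the open half-line
  suffices, since derivatives are local.\<close>

lemma strict_cm_higher_deriv:
  assumes "strict_cm (n + k) h" "\<And>x. x > 0 \<Longrightarrow> f x = h x"
  shows "\<exists>h'. strict_cm n h' \<and> (\<forall>x>0. (deriv ^^ k) f x = (-1) ^ k * h' x)"
  using assms(1)
proof (induction k arbitrary: n)
  case 0
  then show ?case using assms(2) by auto
next
  case (Suc k)
  from Suc.IH[of "Suc n"] Suc.prems obtain h' where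
    h': "strict_cm (Suc n) h'" "\<And>x. x > 0 \<Longrightarrow> (deriv ^^ k) f x = (-1) ^ k * h' x" by auto
  obtain g where g: "\<And>x. x > 0 \<Longrightarrow> (h' has_real_derivative - g x) (at x)" "strict_cm n g"
    using h'(1) by (rule strict_cm_SucE) (rule that)
  have "((deriv ^^ k) f has_real_derivative (-1) ^ k * - g x) (at x)" if "x > 0" for x
  proof (rule has_field_derivative_transform_within_open)
    show "((\<lambda>x. (-1) ^ k * h' x) has_real_derivative (-1) ^ k * - g x) (at x)"
      by (intro DERIV_cmult g that)
  qed (use h'(2) that in \<open>auto intro: open_greaterThan\<close>)
  then show ?case using g(2) by (auto simp: DERIV_imp_deriv intro!: exI[of _ g])
qed

text \<open>The witness may depend on the order. Taking order \<open>1 + n\<close> leaves one more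
  derivative after \<open>n\<close> differentiations.\<close>

lemma strict_cm_imp_smooth_pos:
  assumes "\<And>n. \<exists>h. strict_cm n h \<and> (\<forall>x>0. f x = h x)"
  shows "smooth_pos f"
  unfolding smooth_pos_def
proof (intro allI impI)
  fix n and x :: real assume x: "x > 0"
  obtain h where "strict_cm (1 + n) h" "\<And>x. x > 0 \<Longrightarrow> f x = h x"
    using assms[of "1 + n"] by auto
  then obtain h' where
    h': "strict_cm 1 h'" "\<And>x. x > 0 \<Longrightarrow> (deriv ^^ n) f x = (-1) ^ n * h' x"
    using strict_cm_higher_deriv by blast
  then obtain g where g: "\<And>x. x > 0 \<Longrightarrow> (h' has_real_derivative - g x) (at x)" by auto
  have "((deriv ^^ n) f has_real_derivative (-1) ^ n * - g x) (at x)"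
  proof (rule has_field_derivative_transform_within_open)
    show "((\<lambda>x. (-1) ^ n * h' x) has_real_derivative (-1) ^ n * - g x) (at x)"
      by (intro DERIV_cmult g x)
  qed (use h'(2) x in \<open>auto intro: open_greaterThan\<close>)
  then show "(deriv ^^ n) f field_differentiable at x"
    by (auto simp: field_differentiable_def)
qed

lemma strict_cm_imp_sign:
  assumes "\<And>n. \<exists>h. strict_cm n h \<and> (\<forall>x>0. f x = h x)" and "x > 0"
  shows "(-1) ^ n * (deriv ^^ n) f x > 0"
proof -
  obtain h where "strict_cm (0 + n) h" "\<And>x. x > 0 \<Longrightarrow> f x = h x"
    using assms(1)[of "0 + n"] by auto
  then obtain h' where
    h': "strict_cm 0 h'" "(deriv ^^ n) f x = (-1) ^ n * h' x"
    using strict_cm_higher_deriv assms(2) by blast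
  have "(-1) ^ n * (deriv ^^ n) f x = h' x"
    unfolding h'(2) by (simp flip: mult.assoc power_mult_distrib)
  then show ?thesis using h'(1) assms(2) by simp
qed

section \<open>The logarithmic factors\<close>

text \<open>The strict tangent-line bound for the concave \<open>ln\<close>, with tangent at
  \<open>1 + x\<close>; the companion upper bound uses the tangent at \<open>x\<close>.\<close>

lemma ln_quotient_gt: "x > (0::real) \<Longrightarrow> ln (1 + x) - ln x > 1 / (1 + x)"
  using ln_diff_less[of x "1 + x"] by (simp add: diff_divide_distrib)

lemma ln_quotient_less: "x > (0::real) \<Longrightarrow> ln (1 + x) - ln x < 1 / x"
  using ln_diff_less[of "1 + x" x] by simp

lemma strict_cm_ln_quotient: "strict_cm n (\<lambda>x. ln (1 + x) - ln x)"
\<comment> \<open>Aiming at order \<open>Suc n\<close> lets the derivative rule apply for every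
  \<open>n\<close> without a case split.\<close>
proof (rule strict_cm_pred, rule strict_cm_SucI)
  fix x :: real assume x: "x > 0"
  then show "ln (1 + x) - ln x > 0" by simp
  \<comment> \<open>The shapes \<open>x + 0\<close> and \<open>Suc 0\<close> match
    \<open>strict_cm_inverse_power\<close> with shifts 0 and 1.\<close>
  show "((\<lambda>x. ln (1 + x) - ln x) has_real_derivative
      - (1 / (x + 0) ^ Suc 0 * (1 / (x + 1) ^ Suc 0))) (at x)"
    using x by (auto intro!: derivative_eq_intros simp: divide_simps)
next
  show "strict_cm n (\<lambda>x::real. 1 / (x + 0) ^ Suc 0 * (1 / (x + 1) ^ Suc 0))"
    by (intro strict_cm_mult strict_cm_inverse_power) auto
qed

text \<open>This function is the derivative of \<open>x * (ln (1 + x) - ln x)\<close>, the first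
  summand of \<open>G\<close>.\<close>

lemma strict_cm_ln_quotient_minus: "strict_cm n (\<lambda>x. ln (1 + x) - ln x - 1 / (1 + x))"
proof (rule strict_cm_pred, rule strict_cm_SucI)
  fix x :: real assume x: "x > 0"
  then show "ln (1 + x) - ln x - 1 / (1 + x) > 0" using ln_quotient_gt by simp
  show "((\<lambda>x. ln (1 + x) - ln x - 1 / (1 + x)) has_real_derivative
      - (1 / (x + 0) ^ Suc 0 * (1 / (x + 1) ^ Suc 1))) (at x)"
  proof -
    have "((\<lambda>x. ln (1 + x) - ln x - 1 / (1 + x)) has_real_derivative 1 / (1 + x) - 1 / x + 1 / ((1 + x) * (1 + x))) (at x)"
      using x by (auto intro!: derivative_eq_intros)
    moreover have "1 / (1 + x) - 1 / x + 1 / ((1 + x) * (1 + x)) = - (1 / (x + 0) ^ Suc 0 * (1 / (x + 1) ^ Suc 1))"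
      using x by (simp add: divide_simps) (simp add: algebra_simps)
    ultimately show ?thesis by simp
  qed
next
  show "strict_cm n (\<lambda>x::real. 1 / (x + 0) ^ Suc 0 * (1 / (x + 1) ^ Suc 1))"
    by (intro strict_cm_mult strict_cm_inverse_power) auto
qed

text \<open>This function is minus the derivative of
  \<open>(1 + x) * (ln (1 + x) - ln x)\<close>.\<close>

lemma strict_cm_inverse_minus_ln_quotient: "strict_cm n (\<lambda>x. 1 / x - (ln (1 + x) - ln x))"
proof (rule strict_cm_pred, rule strict_cm_SucI)
  fix x :: real assume x: "x > 0"
  then show "1 / x - (ln (1 + x) - ln x) > 0" using ln_quotient_less by simp
  show "((\<lambda>x. 1 / x - (ln (1 + x) - ln x)) has_real_derivative
      - (1 / (x + 0) ^ Suc 1 * (1 / (x + 1) ^ Suc 0))) (at x)"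
  proof -
    have "((\<lambda>x. 1 / x - (ln (1 + x) - ln x)) has_real_derivative - (1 / (x * x)) - (1 / (1 + x) - 1 / x)) (at x)"
      using x by (auto intro!: derivative_eq_intros)
    moreover have "- (1 / (x * x)) - (1 / (1 + x) - 1 / x) = - (1 / (x + 0) ^ Suc 1 * (1 / (x + 1) ^ Suc 0))"
      using x by (simp add: divide_simps)
    ultimately show ?thesis by simp
  qed
next
  show "strict_cm n (\<lambda>x::real. 1 / (x + 0) ^ Suc 1 * (1 / (x + 1) ^ Suc 0))"
    by (intro strict_cm_mult strict_cm_inverse_power) auto
qed

text \<open>The factor \<open>1 + x\<close> increases, so closure under products does not apply; the
  derivative is treated directly.\<close>

lemma strict_cm_mult_ln_quotient: "strict_cm n (\<lambda>x. (1 + x) * (ln (1 + x) - ln x))"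
proof (rule strict_cm_pred, rule strict_cm_SucI)
  fix x :: real assume x: "x > 0"
  then show "(1 + x) * (ln (1 + x) - ln x) > 0" by simp
  show "((\<lambda>x. (1 + x) * (ln (1 + x) - ln x)) has_real_derivative
      - (1 / x - (ln (1 + x) - ln x))) (at x)"
    using x by (auto intro!: derivative_eq_intros simp: divide_simps)
qed (rule strict_cm_inverse_minus_ln_quotient)

section \<open>The integral factor\<close>

text \<open>Differentiating \<open>(1 + x) powr (- b)\<close> \<open>k\<close> times produces, up to
  sign, the factor \<open>b (b + 1) ... (b + k - 1)\<close>. Including \<open>k\<close> closes the
  induction; the application takes \<open>k = 0\<close>.\<close>

lemma strict_cm_powr_integral:
  "strict_cm n (\<lambda>x. integral {0..1} (\<lambda>b. pochhammer b k * (1 + x) powr (- b - real k)))"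
proof (induction n arbitrary: k)
  case 0
  have "integral {0..1} (\<lambda>b. pochhammer b k * (1 + x) powr (- b - real k)) > 0"
    if x: "x > 0" for x :: real
  proof -
    let ?f = "\<lambda>b::real. pochhammer b k * (1 + x) powr (- b - real k)"
    have cont: "continuous_on {0..1} ?f"
      using x by (auto intro!: continuous_intros simp: pochhammer_prod)
    have nonneg: "?f b \<ge> 0" if "b \<in> {0..1}" for b
      using that by (intro mult_nonneg_nonneg) (auto simp: pochhammer_nonneg pochhammer_prod intro!: prod_nonneg)
    \<comment> \<open>For \<open>k > 0\<close> the integrand vanishes at \<open>b = 0\<close>, so
      strictness is read off at \<open>b = 1\<close>, where the Pochhammer factor is
      \<open>fact k\<close>.\<close>
    have "integral {0..1} ?f \<noteq> 0"
    proof
      assume "integral {0..1} ?f = 0"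
      then have "\<forall>b\<in>{0..1}. ?f b = 0"
        using integral_eq_0_iff[OF cont] nonneg by simp
      then have "?f 1 = 0" by (rule bspec) simp
      then show False using x by (simp add: pochhammer_fact[symmetric])
    qed
    moreover have "integral {0..1} ?f \<ge> 0"
      using nonneg by (intro integral_nonneg integrable_continuous_real cont)
    ultimately show ?thesis by simp
  qed
  then show ?case by simp
next
  case (Suc n)
  show ?case
  proof (rule strict_cm_SucI)
    fix x :: real assume x: "x > 0"
    show "integral {0..1} (\<lambda>b. pochhammer b k * (1 + x) powr (- b - real k)) > 0"
      using Suc.IH[of k] x by (rule strict_cm_pos)
    \<comment> \<open>Differentiation under the integral sign on the convex set
      \<open>{0<..}\<close>; its openness then removes the restriction.\<close>
    have "((\<lambda>x. integral (cbox 0 1) (\<lambda>b. pochhammer b k * (1 + x) powr (- b - real k)))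
        has_real_derivative integral (cbox 0 1)
          (\<lambda>b. - (pochhammer b (Suc k) * (1 + x) powr (- b - real (Suc k))))) (at x within {0<..})"
    proof (rule leibniz_rule_field_derivative)
      fix y b :: real assume y: "y \<in> {0<..}" and b: "b \<in> cbox 0 1"
      have "((\<lambda>x. (1 + x) powr (- b - real k)) has_real_derivative
          (- b - real k) * (1 + y) powr (- b - real k - 1)) (at y within {0<..})"
        using y by (auto intro!: derivative_eq_intros simp: algebra_simps)
      from DERIV_cmult[OF this, of "pochhammer b k"] show "((\<lambda>x. pochhammer b k * (1 + x) powr (- b - real k)) has_real_derivative
          - (pochhammer b (Suc k) * (1 + y) powr (- b - real (Suc k)))) (at y within {0<..})"
        by (simp add: pochhammer_Suc algebra_simps)
    next
      fix y :: real assume "y \<in> {0<..}"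
      then show "(\<lambda>b. pochhammer b k * (1 + y) powr (- b - real k)) integrable_on cbox 0 1"
        by (intro integrable_continuous) (auto intro!: continuous_intros simp: pochhammer_prod)
    next
      show "continuous_on ({0<..} \<times> cbox 0 1)
          (\<lambda>(y, b). - (pochhammer b (Suc k) * (1 + y) powr (- b - real (Suc k))))"
        by (auto intro!: continuous_intros simp: pochhammer_prod case_prod_unfold)
    qed (use x in auto)
    then show "((\<lambda>x. integral {0..1} (\<lambda>b. pochhammer b k * (1 + x) powr (- b - real k)))
        has_real_derivative
        - integral {0..1} (\<lambda>b. pochhammer b (Suc k) * (1 + x) powr (- b - real (Suc k)))) (at x)"
      using x by (simp add: at_within_open[OF _ open_greaterThan])
  next
    show "strict_cm n (\<lambda>x. integral {0..1}
        (\<lambda>b. pochhammer b (Suc k) * (1 + x) powr (- b - real (Suc k))))"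
      by (rule Suc.IH)
  qed
qed

lemma powr_integral_eq:
  assumes "x > (0::real)"
  shows "integral {0..1} (\<lambda>b. (1 + x) powr (- b)) = x / ((1 + x) * ln (1 + x))"
proof -
  \<comment> \<open>The antiderivative in \<open>b\<close> is
    \<open>- ((1 + x) powr (- b)) / ln (1 + x)\<close>, evaluated at 1 and 0.\<close>
  have "((\<lambda>b. (1 + x) powr (- b)) has_integral
      - ((1 + x) powr (- 1)) / ln (1 + x) - - ((1 + x) powr (- 0)) / ln (1 + x)) {0..1}"
  proof (rule fundamental_theorem_of_calculus)
    fix b :: real
    have "((\<lambda>b. - ((1 + x) powr (- b)) / ln (1 + x)) has_real_derivative (1 + x) powr (- b))
        (at b within {0..1})"
      using assms by (auto intro!: derivative_eq_intros simp: powr_def)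
    then show "((\<lambda>b. - ((1 + x) powr (- b)) / ln (1 + x)) has_vector_derivative (1 + x) powr (- b))
        (at b within {0..1})"
      by (simp add: has_real_derivative_iff_has_vector_derivative)
  qed simp
  then have "integral {0..1} (\<lambda>b. (1 + x) powr (- b)) =
      - ((1 + x) powr (- 1)) / ln (1 + x) - - ((1 + x) powr (- 0)) / ln (1 + x)"
    by (rule integral_unique)
  also have "\<dots> = x / ((1 + x) * ln (1 + x))"
    using assms by (simp add: powr_minus_divide divide_simps)
  finally show ?thesis .
qed

section \<open>Decomposition of \<open>G\<close> and signs of its derivatives\<close>

text \<open>With \<open>u = L - ln x\<close>, \<open>1 - ln x / L = u / L\<close> and
  \<open>ln x = L - u\<close>, so \<open>G x\<close> is
  \<open>(u / L) * x * (L - u)\<close>.\<close>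

lemma G_eq:
  assumes "x > 0"
  shows "G x = x * (ln (1 + x) - ln x) - (ln (1 + x) - ln x) * ((1 + x) * (ln (1 + x) - ln x)) *
    integral {0..1} (\<lambda>b. (1 + x) powr (- b))"
proof -
  define L where "L = ln (1 + x)"
  have L: "L > 0" "1 + x > 0" using assms by (simp_all add: L_def)
  have "(L - ln x) * ((1 + x) * (L - ln x)) * (x / ((1 + x) * L)) = x * (L - ln x) ^ 2 / L"
    using L by (simp add: power2_eq_square)
  moreover have "(1 - ln x / L) * x * ln x = x * (L - ln x) - x * (L - ln x) ^ 2 / L"
    using L by (simp add: field_simps power2_eq_square)
  ultimately show ?thesis unfolding G_def powr_integral_eq[OF assms] by (simp add: L_def)
qed

lemma G_derivative:
  obtains h where "strict_cm n h" "\<And>x. x > 0 \<Longrightarrow> (G has_real_derivative h x) (at x)"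
proof -
  let ?u = "\<lambda>x::real. ln (1 + x) - ln x"
  let ?F = "\<lambda>x. ?u x * ((1 + x) * ?u x) * integral {0..1} (\<lambda>b. (1 + x) powr (- b))"
  \<comment> \<open>One order more than the goal, because \<open>?F\<close> enters through its
    negated derivative \<open>q\<close>.\<close>
  have "strict_cm (Suc n) ?F"
    using strict_cm_powr_integral[of "Suc n" 0]
    by (intro strict_cm_mult strict_cm_ln_quotient strict_cm_mult_ln_quotient) simp
  then obtain q where q: "\<And>x. x > 0 \<Longrightarrow> (?F has_real_derivative - q x) (at x)" "strict_cm n q"
    by (rule strict_cm_SucE) (rule that)
  show ?thesis
  proof
    show "strict_cm n (\<lambda>x. (?u x - 1 / (1 + x)) + q x)"
      by (intro strict_cm_add strict_cm_ln_quotient_minus q)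
    fix x :: real assume x: "x > 0"
    have "((\<lambda>x. x * ?u x) has_real_derivative ?u x - 1 / (1 + x)) (at x)"
      using x by (auto intro!: derivative_eq_intros simp: divide_simps)
    from DERIV_diff[OF this q(1)[OF x]]
    have "((\<lambda>x. x * ?u x - ?F x) has_real_derivative (?u x - 1 / (1 + x)) + q x) (at x)"
      by simp
    then show "(G has_real_derivative (?u x - 1 / (1 + x)) + q x) (at x)"
      by (rule has_field_derivative_transform_within_open[of _ _ _ "{0<..}"])
        (use x G_eq in auto)
  qed
qed

theorem mainTheorem3:
  shows "smooth_pos G \<and> completely_monotonic (deriv G) \<and>
    (\<forall>k\<ge>1. \<forall>x>0. (-1) ^ (k - 1) * (deriv ^^ k) G x > 0)"
proof -
  have G': "\<exists>h. strict_cm n h \<and> (\<forall>x>0. deriv G x = h x)" for n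
    by (rule G_derivative[of n]) (auto intro: DERIV_imp_deriv)
  have smooth': "smooth_pos (deriv G)" by (rule strict_cm_imp_smooth_pos[OF G'])
  have sign: "(-1) ^ n * (deriv ^^ n) (deriv G) x > 0" if "x > 0" for n x
    by (rule strict_cm_imp_sign[OF G' that])
  have "smooth_pos G"
    unfolding smooth_pos_def
  proof (intro allI impI)
    fix n and x :: real assume x: "x > 0"
    show "(deriv ^^ n) G field_differentiable at x"
    \<comment> \<open>Smoothness of \<open>deriv G\<close> covers the positive orders;
      differentiability of \<open>G\<close> itself comes from \<open>G_derivative\<close>.\<close>
    proof (cases n)
      case 0
      then show ?thesis
        using G_derivative[of 0] x unfolding field_differentiable_def by (metis funpow_0)
    next
      case (Suc m)
      then show ?thesis
        using smooth' x by (simp add: smooth_pos_def funpow_swap1)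
    qed
  qed
  moreover have "completely_monotonic (deriv G)"
    using smooth' sign by (auto simp: completely_monotonic_def intro: less_imp_le)
  \<comment> \<open>Index shift: the derivative of order \<open>k\<close> of \<open>G\<close> is
    that of order \<open>k - 1\<close> of \<open>deriv G\<close>.\<close>
  moreover have "(-1) ^ (k - 1) * (deriv ^^ k) G x > 0" if "k \<ge> 1" "x > 0" for k x
    using sign[OF that(2), of "k - 1"] that(1) by (cases k) (simp_all add: funpow_swap1)
  ultimately show ?thesis by blast
qed

end
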